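(* There is an embedding of the category $(Graphs,hom)$ into the category $(Graphs,cc)$. Explicitly: there is a mapping $F$ assigning to every graph $G$ a graph $F(G)$ such that for all graphs $G,H$ there is a homomorphism $G\to H$ if and only if there is a cut-continuous mapping $E(F(G))\to E(F(H))$. Moreover $F$ extends to morphisms: to each homomorphism $f:G\to H$ it assigns a cut-continuous mapping $F(f):E(F(G))\to E(F(H))$, in such a way that $F$ is an embedding of categories (a functor that is faithful and injective on objects), and every cut-continuous mapping $E(F(G))\to E(F(H))$ is equal to $F(f)$ for some homomorphism $f:G\to H$.
   Context: Graphs are finite, undirected, simple and loopless. A cut in a graph $G=(V,E)$ is the set of all edges with one end in $X$ and the other in $V\setminus X$, for some $X\subseteq V$ (so the empty set is a cut). A mapping $f:E(G)\to E(H)$ is cut-continuous if for every cut $C$ of $H$ the preimage $f^{-1}(C)$ is a cut of $G$. $(Graphs,hom)$ is the category of all graphs with graph homomorphisms (adjacency-preserving vertex maps) as morphisms; $(Graphs,cc)$ is the category of all graphs whose morphisms from $G$ to $H$ are the cut-continuous mappings $E(G)\to E(H)$, with the usual composition of mappings. *)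

theory Defs
  imports "HOL-Library.FuncSet"
begin

text \<open>
  A category is given by its objects and a family of hom-sets indexed by pairs of objects; the
  hom-sets need not be disjoint, so identity and composition take the objects involved as
  arguments: \<open>Comp C A B D g f\<close> is the composite of \<open>f : A \<rightarrow> B\<close> and \<open>g : B \<rightarrow> D\<close>.
\<close>

record ('o, 'm) cat =
  Obj :: "'o set"
  Hom :: "'o \<Rightarrow> 'o \<Rightarrow> 'm set"
  Id :: "'o \<Rightarrow> 'm"
  Comp :: "'o \<Rightarrow> 'o \<Rightarrow> 'o \<Rightarrow> 'm \<Rightarrow> 'm \<Rightarrow> 'm"

locale category =
  fixes C :: "('o, 'm) cat"
  assumes Id_in_Hom: "A \<in> Obj C \<Longrightarrow> Id C A \<in> Hom C A A"
    and Comp_in_Hom: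
      "\<lbrakk>A \<in> Obj C; B \<in> Obj C; D \<in> Obj C; f \<in> Hom C A B; g \<in> Hom C B D\<rbrakk>
        \<Longrightarrow> Comp C A B D g f \<in> Hom C A D"
    and Comp_Id_right:
      "\<lbrakk>A \<in> Obj C; B \<in> Obj C; f \<in> Hom C A B\<rbrakk> \<Longrightarrow> Comp C A A B f (Id C A) = f"
    and Comp_Id_left:
      "\<lbrakk>A \<in> Obj C; B \<in> Obj C; f \<in> Hom C A B\<rbrakk> \<Longrightarrow> Comp C A B B (Id C B) f = f"
    and Comp_assoc:
      "\<lbrakk>A \<in> Obj C; B \<in> Obj C; D \<in> Obj C; K \<in> Obj C;
        f \<in> Hom C A B; g \<in> Hom C B D; h \<in> Hom C D K\<rbrakk>
        \<Longrightarrow> Comp C A B K (Comp C B D K h g) f = Comp C A D K h (Comp C A B D g f)"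

locale cat_functor = source: category C + target: category D
  for C :: "('o, 'm) cat" and D :: "('p, 'n) cat" +
  fixes F :: "'o \<Rightarrow> 'p" and Fm :: "'o \<Rightarrow> 'o \<Rightarrow> 'm \<Rightarrow> 'n"
  assumes F_Obj: "A \<in> Obj C \<Longrightarrow> F A \<in> Obj D"
    and Fm_Hom: "\<lbrakk>A \<in> Obj C; B \<in> Obj C; f \<in> Hom C A B\<rbrakk> \<Longrightarrow> Fm A B f \<in> Hom D (F A) (F B)"
    and Fm_Id: "A \<in> Obj C \<Longrightarrow> Fm A A (Id C A) = Id D (F A)"
    and Fm_Comp:
      "\<lbrakk>A \<in> Obj C; B \<in> Obj C; K \<in> Obj C; f \<in> Hom C A B; g \<in> Hom C B K\<rbrakk>
        \<Longrightarrow> Fm A K (Comp C A B K g f) = Comp D (F A) (F B) (F K) (Fm B K g) (Fm A B f)"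

locale cat_embedding = cat_functor +
  assumes faithful: "\<lbrakk>A \<in> Obj C; B \<in> Obj C\<rbrakk> \<Longrightarrow> inj_on (Fm A B) (Hom C A B)"
    and inj_on_Obj: "inj_on F (Obj C)"


record 'a graph =
  verts :: "'a set"
  edges :: "'a set set"

definition graphs :: "'a graph set" where
  "graphs = {G. finite (verts G) \<and>
     (\<forall>e \<in> edges G. \<exists>u \<in> verts G. \<exists>v \<in> verts G. u \<noteq> v \<and> e = {u, v})}"

text \<open>
  Vertex and edge mappings are extensional functions (\<open>undefined\<close> outside their domain), so that
  equality of HOL functions is equality of mappings.
\<close>

definition graph_hom :: "'a graph \<Rightarrow> 'a graph \<Rightarrow> ('a \<Rightarrow> 'a) \<Rightarrow> bool" where
  "graph_hom G H f \<longleftrightarrow> f \<in> verts G \<rightarrow>\<^sub>E verts H \<and>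
     (\<forall>u v. {u, v} \<in> edges G \<longrightarrow> {f u, f v} \<in> edges H)"

definition is_cut :: "'a graph \<Rightarrow> 'a set set \<Rightarrow> bool" where
  "is_cut G C \<longleftrightarrow> (\<exists>X \<subseteq> verts G. C = {e \<in> edges G. \<exists>u \<in> X. \<exists>v \<in> verts G - X. e = {u, v}})"

definition cut_continuous :: "'a graph \<Rightarrow> 'a graph \<Rightarrow> ('a set \<Rightarrow> 'a set) \<Rightarrow> bool" where
  "cut_continuous G H f \<longleftrightarrow> f \<in> edges G \<rightarrow>\<^sub>E edges H \<and>
     (\<forall>C. is_cut H C \<longrightarrow> is_cut G {e \<in> edges G. f e \<in> C})"

definition Graphs_hom :: "('a graph, 'a \<Rightarrow> 'a) cat" where
  "Graphs_hom = \<lparr>Obj = graphs, Hom = (\<lambda>G H. {f. graph_hom G H f}),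
     Id = (\<lambda>G. restrict id (verts G)), Comp = (\<lambda>G H K g f. compose (verts G) g f)\<rparr>"

definition Graphs_cc :: "('a graph, 'a set \<Rightarrow> 'a set) cat" where
  "Graphs_cc = \<lparr>Obj = graphs, Hom = (\<lambda>G H. {f. cut_continuous G H f}),
     Id = (\<lambda>G. restrict id (edges G)), Comp = (\<lambda>G H K g f. compose (edges G) g f)\<rparr>"

lemma graphs_edge_verts:
  assumes "G \<in> graphs" "{u, v} \<in> edges G"
  shows "u \<in> verts G \<and> v \<in> verts G"
proof -
  have "\<exists>a \<in> verts G. \<exists>b \<in> verts G. a \<noteq> b \<and> {u, v} = {a, b}"
    using assms by (simp add: graphs_def)
  then show ?thesis
    by (auto simp: doubleton_eq_iff)
qed

lemma category_Graphs_hom: "category (Graphs_hom :: ('a graph, 'a \<Rightarrow> 'a) cat)"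
proof (unfold_locales, goal_cases)
  case (1 A)
  have "u \<in> verts A \<and> v \<in> verts A" if "{u, v} \<in> edges A" for u v
    using 1 that graphs_edge_verts by (fastforce simp: Graphs_hom_def)
  then show ?case
    by (fastforce simp: Graphs_hom_def graph_hom_def)
next
  case (2 A B D f g)
  have "u \<in> verts A \<and> v \<in> verts A" if "{u, v} \<in> edges A" for u v
    using 2(1) that graphs_edge_verts by (fastforce simp: Graphs_hom_def)
  then show ?case
    using 2 by (auto simp: Graphs_hom_def graph_hom_def compose_def)
next
  case (3 A B f)
  then show ?case
    by (auto simp: Graphs_hom_def graph_hom_def compose_def fun_eq_iff PiE_def extensional_def)
next
  case (4 A B f)
  then show ?case
    by (auto simp: Graphs_hom_def graph_hom_def compose_def fun_eq_iff PiE_def extensional_def)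
next
  case (5 A B D K f g h)
  then show ?case
    by (auto simp: Graphs_hom_def graph_hom_def compose_def fun_eq_iff)
qed

lemma category_Graphs_cc: "category (Graphs_cc :: ('a graph, 'a set \<Rightarrow> 'a set) cat)"
proof (unfold_locales, goal_cases)
  case (1 A)
  have "{e \<in> edges A. restrict id (edges A) e \<in> C} = C" if "is_cut A C" for C
    using that by (auto simp: is_cut_def)
  then show ?case
    by (auto simp: Graphs_cc_def cut_continuous_def)
next
  case (2 A B D f g)
  then have f: "cut_continuous A B f" and g: "cut_continuous B D g"
    by (simp_all add: Graphs_cc_def)
  have "is_cut A {e \<in> edges A. compose (edges A) g f e \<in> C}" if "is_cut D C" for C
  proof -
    have "is_cut A {e \<in> edges A. f e \<in> {e \<in> edges B. g e \<in> C}}"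
      using f g that unfolding cut_continuous_def by blast
    also have "{e \<in> edges A. f e \<in> {e \<in> edges B. g e \<in> C}}
        = {e \<in> edges A. compose (edges A) g f e \<in> C}"
      using f by (auto simp: cut_continuous_def compose_def)
    finally show ?thesis .
  qed
  moreover have "compose (edges A) g f \<in> edges A \<rightarrow>\<^sub>E edges D"
    using f g by (auto simp: cut_continuous_def compose_def)
  ultimately show ?case
    by (simp add: Graphs_cc_def cut_continuous_def)
next
  case (3 A B f)
  then show ?case
    by (auto simp: Graphs_cc_def cut_continuous_def compose_def fun_eq_iff PiE_def extensional_def)
next
  case (4 A B f)
  then show ?case
    by (auto simp: Graphs_cc_def cut_continuous_def compose_def fun_eq_iff PiE_def extensional_def)
next
  case (5 A B D K f g h)
  then show ?case
    by (auto simp: Graphs_cc_def cut_continuous_def compose_def fun_eq_iff)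
qed

end

theory Submission
  imports Defs
begin

text \<open>
  On a triangle \<open>abc\<close> a cut-continuous mapping \<open>h\<close> satisfies \<open>h(bc) = h(ab) \<triangle> h(ac)\<close>, because the
  preimages of the stars of the target are cuts. On a \<open>K\<^sub>5\<close> this makes the images of the four
  edges at a vertex pairwise meet, so they share a common vertex, and \<open>h\<close> is induced by a vertex
  map. Hence on a cone over a graph whose edges lie in copies of \<open>K\<^sub>4\<close> that are chained along common
  edges, every cut-continuous mapping is induced by a homomorphism.

  It remains to represent graphs by such cones and their homomorphisms. Fix a rigid graph on
  \<open>D0, \<dots>, D9\<close>, a triangle \<open>P, Q, R\<close> attached to it, and replace \<open>P\<close> by one copy for each vertex
  of \<open>G\<close>, and \<open>Q, R\<close> by one copy each for every orientation \<open>(u, v)\<close> of an edge, joined in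
  a path \<open>Vert u, Tail u v, Head u v, Vert v\<close>. Colouring the copies by \<open>P, Q, R\<close> shows that a
  homomorphism between two such cones fixes the rigid part and preserves colours, so it comes from
  a homomorphism of the represented graphs.
\<close>

section \<open>A rigid graph\<close>

datatype colour = D0 | D1 | D2 | D3 | D4 | D5 | D6 | D7 | D8 | D9 | P | Q | R

definition base_colours :: "colour list" where
  "base_colours = [D0, D1, D2, D3, D4, D5, D6, D7, D8, D9]"

definition colours :: "colour list" where
  "colours = base_colours @ [P, Q, R]"

abbreviation base :: "colour set" where
  "base \<equiv> set base_colours"

text \<open>
  The graph was found by a computer search for the properties \<open>rigid\<close>, \<open>link_three_colourable\<close>,
  \<open>undominated\<close> and \<open>edge_in_K4\<close> below.
\<close>

fun nbrs :: "colour \<Rightarrow> colour list" where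
  "nbrs D0 = [D1, D2, D3, D4, D5, D6, D9, P, Q, R]"
| "nbrs D1 = [D0, D2, D3, D4, Q]"
| "nbrs D2 = [D0, D1, D3, D6, D8, D9, Q, R]"
| "nbrs D3 = [D0, D1, D2, D4, D5, D7, R]"
| "nbrs D4 = [D0, D1, D3, D5, D7]"
| "nbrs D5 = [D0, D3, D4, D6, D7, D8, P, Q]"
| "nbrs D6 = [D0, D2, D5, D7, D8, D9, P, R]"
| "nbrs D7 = [D3, D4, D5, D6, D8, Q]"
| "nbrs D8 = [D2, D5, D6, D7, D9, Q]"
| "nbrs D9 = [D0, D2, D6, D8]"
| "nbrs P = [D0, D5, D6, Q, R]"
| "nbrs Q = [D0, D1, D2, D5, D7, D8, P, R]"
| "nbrs R = [D0, D2, D3, D6, P, Q]"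

definition adj :: "colour \<Rightarrow> colour \<Rightarrow> bool" where
  "adj c d \<longleftrightarrow> d \<in> set (nbrs c)"

lemma set_colours: "c \<in> set colours"
  by (cases c) (simp_all add: colours_def base_colours_def)

lemma base_iff: "c \<in> base \<longleftrightarrow> c \<noteq> P \<and> c \<noteq> Q \<and> c \<noteq> R"
  by (cases c) (simp_all add: base_colours_def)

lemma adj_sym: "adj c d \<longleftrightarrow> adj d c"
  by (cases c; cases d; simp add: adj_def)

lemma adj_irrefl: "\<not> adj c c"
  by (cases c; simp add: adj_def)

text \<open>
  A backtracking search: \<open>as\<close> is a partial homomorphism, and every extension of it to \<open>vs\<close> has to
  be the identity.
\<close>

fun forced :: "colour list \<Rightarrow> (colour \<times> colour) list \<Rightarrow> bool" where
  "forced [] as \<longleftrightarrow> list_all (\<lambda>(v, c). v = c) as"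
| "forced (v # vs) as \<longleftrightarrow>
     (let ds = map snd (filter (\<lambda>(w, d). adj w v) as)
      in list_all (\<lambda>c. forced vs ((v, c) # as)) (filter (\<lambda>c. list_all (\<lambda>d. adj d c) ds) colours))"

text \<open>Induction on \<open>vs\<close>. The value \<open>f w\<close> is among the candidates
  tried at \<open>w\<close>, since \<open>f\<close> respects the edges from \<open>w\<close> to the
  vertices already assigned, so the branch recording it succeeds as well.\<close>

lemma forced_sound:
  assumes "forced vs as"
    and "\<And>v w. v \<in> S \<Longrightarrow> w \<in> S \<Longrightarrow> adj v w \<Longrightarrow> adj (f v) (f w)"
    and "set vs \<subseteq> S" "\<And>v c. (v, c) \<in> set as \<Longrightarrow> v \<in> S \<and> f v = c"
    and "v \<in> set vs \<union> fst ` set as"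
  shows "f v = v"
  using assms(1,3-)
proof (induction vs arbitrary: "as")
  case Nil
  then show ?case by (auto simp: list_all_iff)
next
  case (Cons w vs)
  have "adj d (f w)" if "(u, d) \<in> set as" "adj u w" for u d
    using assms(2)[of u w] Cons.prems that by auto
  then have "forced vs ((w, f w) # as)"
    using Cons.prems(1) set_colours by (fastforce simp: list_all_iff Let_def)
  then show ?case
    by (rule Cons.IH) (use Cons.prems in auto)
qed

lemma forced_base: "forced base_colours []"
  by code_simp

text \<open>\<open>forced\<close> tries all thirteen colours as images, so \<open>f\<close> need not
  map the base into itself. This matters below, where the image colours are not known
  beforehand.\<close>

lemma rigid:
  assumes "\<And>v w. v \<in> base \<Longrightarrow> w \<in> base \<Longrightarrow> adj v w \<Longrightarrow> adj (f v) (f w)" "c \<in> base"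
  shows "f c = c"
  using forced_sound[OF forced_base, of base f c] assms by auto

text \<open>Two classes of a proper 3-colouring of the neighbourhood of each vertex; the neighbours
  not listed form the third class.\<close>

fun link_classes :: "colour \<Rightarrow> colour list \<times> colour list" where
  "link_classes D0 = ([D1, D5, D9, R], [D2, D4, P])"
| "link_classes D1 = ([D0], [D2, D4])"
| "link_classes D2 = ([D0, D8], [D1, D9, R])"
| "link_classes D3 = ([D0, D7], [D1, D5, R])"
| "link_classes D4 = ([D0, D7], [D1, D5])"
| "link_classes D5 = ([D0, D7], [D3, D6, Q])"
| "link_classes D6 = ([D0, D8], [D2, D7, P])"
| "link_classes D7 = ([D3, D6, Q], [D4, D8])"
| "link_classes D8 = ([D2, D5], [D6, Q])"
| "link_classes D9 = ([D0, D8], [D2])"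
| "link_classes P = ([D0], [D5, R])"
| "link_classes Q = ([D0, D8], [D1, D5, R])"
| "link_classes R = ([D0], [D2, P])"

text \<open>The three classes are named \<open>D1\<close>, \<open>D2\<close>, \<open>D3\<close>
  because these span a \<open>K4\<close> with \<open>D0\<close>: a colouring becomes a map between
  colours, to which \<open>rigid\<close> applies, and \<open>D0\<close> remains free for an
  apex.\<close>

definition link_fold :: "colour \<Rightarrow> colour \<Rightarrow> colour" where
  "link_fold w c = (if c \<in> set (fst (link_classes w)) then D1
     else if c \<in> set (snd (link_classes w)) then D2 else D3)"

lemma link_three_colourable:
  assumes "adj w c" "adj w d" "adj c d"
  shows "adj (link_fold w c) (link_fold w d)"
proof -
  have "list_all (\<lambda>w. list_all (\<lambda>c. list_all (\<lambda>d. adj c d \<longrightarrow> adj (link_fold w c) (link_fold w d))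
      (nbrs w)) (nbrs w)) colours"
    by code_simp
  then show ?thesis
    using assms set_colours by (auto simp: list_all_iff adj_def)
qed

lemma link_fold_D0: "adj D0 (link_fold w c)" "adj (link_fold w c) D0"
  by (simp_all add: link_fold_def adj_def)

text \<open>Checked by enumeration. It recovers the colour of the image of a copy of
  \<open>P\<close>, \<open>Q\<close> or \<open>R\<close> once the base is known to be fixed.\<close>

lemma undominated:
  assumes "c \<notin> base" "\<And>b. b \<in> base \<Longrightarrow> adj c b \<Longrightarrow> adj d b"
  shows "d = c"
proof -
  have "list_all (\<lambda>c. list_all (\<lambda>d. list_all (\<lambda>b. adj c b \<longrightarrow> adj d b) base_colours \<longrightarrow> d = c) colours) [P, Q, R]"
    by code_simp
  then show ?thesis
    using assms set_colours[of d] base_iff[of c] by (auto simp: list_all_iff)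
qed

text \<open>The two further vertices are taken in the base because a node is adjacent to every base
  node that its colour allows, whereas between copies of \<open>P\<close>, \<open>Q\<close>,
  \<open>R\<close> incidence is required too.\<close>

lemma edge_in_K4:
  assumes "adj c d"
  obtains a b where "a \<in> base" "b \<in> base" "adj a b"
    "adj c a" "adj c b" "adj d a" "adj d b"
proof -
  have "list_all (\<lambda>c. list_all (\<lambda>d. list_ex (\<lambda>a. list_ex (\<lambda>b.
      adj a b \<and> adj c a \<and> adj c b \<and> adj d a \<and> adj d b) base_colours) base_colours) (nbrs c)) colours"
    by code_simp
  then show thesis
    using assms set_colours[of c] that by (force simp: list_all_iff list_ex_iff adj_def)
qed

lemma ex_base_adj: "\<exists>b\<in>base. adj c b"
  by (cases c; simp add: adj_def base_colours_def)

section \<open>Cut-continuous mappings\<close>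

lemma graphs_edgeE:
  assumes "G \<in> graphs" "e \<in> edges G"
  obtains u v where "u \<in> verts G" "v \<in> verts G" "u \<noteq> v" "e = {u, v}"
  using assms by (auto simp: graphs_def)

text \<open>The preimage of the cut given by \<open>X\<close> is the cut given by the vertices that
  \<phi> sends into \<open>X\<close>.\<close>

lemma cut_continuous_of_hom:
  assumes G: "G \<in> graphs" and H: "H \<in> graphs"
    and V: "\<And>v. v \<in> verts G \<Longrightarrow> \<phi> v \<in> verts H"
    and E: "\<And>u v. {u, v} \<in> edges G \<Longrightarrow> {\<phi> u, \<phi> v} \<in> edges H"
  shows "cut_continuous G H (restrict ((`) \<phi>) (edges G))"
  unfolding cut_continuous_def
proof (intro conjI allI impI)
  have "\<phi> ` e \<in> edges H" if "e \<in> edges G" for e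
  proof -
    obtain u v where "e = {u, v}"
      using graphs_edgeE[OF G \<open>e \<in> edges G\<close>] by blast
    then show ?thesis
      using E \<open>e \<in> edges G\<close> by simp
  qed
  then show "restrict ((`) \<phi>) (edges G) \<in> edges G \<rightarrow>\<^sub>E edges H"
    by auto
next
  fix C assume "is_cut H C"
  then obtain X where X: "X \<subseteq> verts H"
    "C = {e \<in> edges H. \<exists>u\<in>X. \<exists>v\<in>verts H - X. e = {u, v}}"
    by (auto simp: is_cut_def)
  define Y where "Y = {v \<in> verts G. \<phi> v \<in> X}"
  have "\<phi> ` e \<in> C \<longleftrightarrow> (\<exists>u\<in>Y. \<exists>v\<in>verts G - Y. e = {u, v})" if e: "e \<in> edges G" for e
  proof -
    obtain u v where uv: "u \<in> verts G" "v \<in> verts G" "u \<noteq> v" "e = {u, v}"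
      using graphs_edgeE[OF G e] by blast
    have "{\<phi> u, \<phi> v} \<in> edges H"
      using E e uv by blast
    then have "\<phi> ` e \<in> C \<longleftrightarrow> (\<phi> u \<in> X) \<noteq> (\<phi> v \<in> X)"
      using V uv X(2) by (auto simp: doubleton_eq_iff)
    also have "\<dots> \<longleftrightarrow> (\<exists>u\<in>Y. \<exists>v\<in>verts G - Y. e = {u, v})"
      using uv unfolding Y_def by (auto simp: doubleton_eq_iff)
    finally show ?thesis .
  qed
  then have "{e \<in> edges G. restrict ((`) \<phi>) (edges G) e \<in> C}
      = {e \<in> edges G. \<exists>u\<in>Y. \<exists>v\<in>verts G - Y. e = {u, v}}"
    by auto
  then show "is_cut G {e \<in> edges G. restrict ((`) \<phi>) (edges G) e \<in> C}"
    unfolding is_cut_def by (intro exI[of _ Y]) (auto simp: Y_def)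
qed

text \<open>The edges of \<open>H\<close> at \<open>p\<close> form a cut; \<open>W\<close> is one
  side of its preimage.\<close>

lemma cut_continuous_star:
  assumes G: "G \<in> graphs" and H: "H \<in> graphs" and h: "cut_continuous G H h"
  obtains W where "\<And>x y. {x, y} \<in> edges G \<Longrightarrow> p \<in> h {x, y} \<longleftrightarrow> (x \<in> W) \<noteq> (y \<in> W)"
proof -
  define C where "C = {e \<in> edges H. p \<in> e}"
  have hE: "h e \<in> edges H" if "e \<in> edges G" for e
    using h that by (auto simp: cut_continuous_def)
  have "is_cut H C"
    unfolding is_cut_def
  proof (intro exI conjI)
    \<comment> \<open>The intersection covers the case that \<open>p\<close> is not a vertex of
      \<open>H\<close>, where the star is the empty cut.\<close>
    show "{p} \<inter> verts H \<subseteq> verts H" by simp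
    show "C = {e \<in> edges H. \<exists>u\<in>{p} \<inter> verts H. \<exists>v\<in>verts H - {p} \<inter> verts H. e = {u, v}}"
    proof (intro set_eqI iffI)
      fix e assume "e \<in> C"
      then have e: "e \<in> edges H" "p \<in> e" by (auto simp: C_def)
      then obtain u v where "u \<in> verts H" "v \<in> verts H" "u \<noteq> v" "e = {u, v}"
        using graphs_edgeE[OF H] by blast
      with e show "e \<in> {e \<in> edges H. \<exists>u\<in>{p} \<inter> verts H. \<exists>v\<in>verts H - {p} \<inter> verts H. e = {u, v}}"
        by (cases "p = u") auto
    qed (auto simp: C_def)
  qed
  then obtain W where W: "{e \<in> edges G. h e \<in> C}
      = {e \<in> edges G. \<exists>u\<in>W. \<exists>v\<in>verts G - W. e = {u, v}}"
    using h unfolding cut_continuous_def is_cut_def[of G] by blast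
  have "p \<in> h {x, y} \<longleftrightarrow> (x \<in> W) \<noteq> (y \<in> W)" if xy: "{x, y} \<in> edges G" for x y
  proof -
    have "p \<in> h {x, y} \<longleftrightarrow> {x, y} \<in> {e \<in> edges G. h e \<in> C}"
      using xy hE by (simp add: C_def)
    also have "\<dots> \<longleftrightarrow> (\<exists>u\<in>W. \<exists>v\<in>verts G - W. {x, y} = {u, v})"
      using xy unfolding W by simp
    also have "\<dots> \<longleftrightarrow> (x \<in> W) \<noteq> (y \<in> W)"
      using graphs_edge_verts[OF G xy] by (auto simp: doubleton_eq_iff)
    finally show ?thesis .
  qed
  then show thesis by (rule that)
qed

text \<open>Parity: going once round a triangle, membership in \<open>W\<close> changes an even
  number of times, so each \<open>p\<close> lies in none or two of the three images.\<close>

lemma cut_continuous_triangle: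
  assumes "G \<in> graphs" "H \<in> graphs" "cut_continuous G H h"
    and "{a, b} \<in> edges G" "{a, c} \<in> edges G" "{b, c} \<in> edges G"
  shows "h {b, c} = sym_diff (h {a, b}) (h {a, c})"
proof -
  have "p \<in> h {b, c} \<longleftrightarrow> (p \<in> h {a, b}) \<noteq> (p \<in> h {a, c})" for p
    using cut_continuous_star[OF assms(1-3), of p] assms(4-6) by metis
  then show ?thesis by auto
qed

text \<open>Equal pairs have empty symmetric difference, and disjoint ones have a symmetric
  difference of four elements.\<close>

lemma card2_meet:
  assumes "card A = 2" "card B = 2" "card (sym_diff A B) = 2"
  shows "A \<noteq> B \<and> A \<inter> B \<noteq> {}"
proof
  show "A \<noteq> B" using assms by auto
  show "A \<inter> B \<noteq> {}"
  proof
    assume "A \<inter> B = {}"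
    then have "sym_diff A B = A \<union> B" by blast
    moreover have "finite A" "finite B"
      using assms card.infinite by fastforce+
    ultimately show False
      using assms \<open>A \<inter> B = {}\<close> card_Un_disjoint[of A B] by simp
  qed
qed

text \<open>
  Four distinct two-element sets that meet pairwise form a star, since the only other pairwise
  meeting family is a triangle, which has three members.
\<close>

lemma four_pairs_star:
  assumes c: "card A = 2" "card B = 2" "card C = 2" "card D = 2"
    and d: "card (sym_diff A B) = 2" "card (sym_diff A C) = 2" "card (sym_diff A D) = 2"
      "card (sym_diff B C) = 2" "card (sym_diff B D) = 2" "card (sym_diff C D) = 2"
    and p: "p \<in> A" "p \<in> B"
  shows "p \<in> C"
proof (rule ccontr)
  assume "p \<notin> C"
  obtain a where a: "A = {p, a}" "p \<noteq> a"
    using c(1) p(1) by (metis card_2_iff doubleton_eq_iff insertE singletonD)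
  obtain b where b: "B = {p, b}" "p \<noteq> b"
    using c(2) p(2) by (metis card_2_iff doubleton_eq_iff insertE singletonD)
  have "a \<noteq> b" using card2_meet[OF c(1,2) d(1)] a b by blast
  have "a \<in> C" "b \<in> C"
    using card2_meet[OF c(1,3) d(2)] card2_meet[OF c(2,3) d(4)] a b \<open>p \<notin> C\<close> by blast+
  then have C: "C = {a, b}"
    using c(3) \<open>a \<noteq> b\<close> by (auto simp: card_2_iff)
  obtain x y where D: "D = {x, y}" "x \<noteq> y"
    using c(4) by (auto simp: card_2_iff)
  have "D \<noteq> A" "D \<noteq> B" "D \<noteq> C" "D \<inter> A \<noteq> {}" "D \<inter> B \<noteq> {}" "D \<inter> C \<noteq> {}"
    using card2_meet[OF c(1,4) d(3)] card2_meet[OF c(2,4) d(5)] card2_meet[OF c(3,4) d(6)] by blast+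
  \<comment> \<open>\<open>A\<close>, \<open>B\<close>, \<open>C\<close> are the sides of the
    triangle on \<open>p\<close>, \<open>a\<close>, \<open>b\<close>. A pair that meets all three
    sides contains two corners, hence is itself a side.\<close>
  then show False
    unfolding a b C D using a(2) b(2) \<open>a \<noteq> b\<close> by (auto simp: insert_commute)
qed

section \<open>The construction\<close>

datatype 'a node = Base colour | Vert 'a | Tail 'a 'a | Head 'a 'a

primrec node_colour :: "'a node \<Rightarrow> colour" where
  "node_colour (Base c) = c"
| "node_colour (Vert u) = P"
| "node_colour (Tail u v) = Q"
| "node_colour (Head u v) = R"

text \<open>The default \<open>True\<close> concerns pairs with a \<open>Base\<close> node, where
  colours alone decide, and pairs of the same kind, whose equal colours are never adjacent.\<close>

fun incident :: "'a node \<Rightarrow> 'a node \<Rightarrow> bool" where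
  "incident (Vert u) (Tail a b) \<longleftrightarrow> u = a"
| "incident (Tail a b) (Vert u) \<longleftrightarrow> u = a"
| "incident (Vert u) (Head a b) \<longleftrightarrow> u = b"
| "incident (Head a b) (Vert u) \<longleftrightarrow> u = b"
| "incident (Tail a b) (Head c d) \<longleftrightarrow> a = c \<and> b = d"
| "incident (Head c d) (Tail a b) \<longleftrightarrow> a = c \<and> b = d"
| "incident _ _ \<longleftrightarrow> True"

text \<open>As \<open>{u, v} = {v, u}\<close>, every edge contributes a \<open>Tail\<close> and a
  \<open>Head\<close> for both of its orientations.\<close>

definition nodes :: "'a graph \<Rightarrow> 'a node set" where
  "nodes G = Base ` base \<union> Vert ` verts G \<union> {Tail u v | u v. {u, v} \<in> edges G}
     \<union> {Head u v | u v. {u, v} \<in> edges G}"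

definition node_adj :: "'a graph \<Rightarrow> 'a node \<Rightarrow> 'a node \<Rightarrow> bool" where
  "node_adj G s t \<longleftrightarrow> s \<in> nodes G \<and> t \<in> nodes G \<and> adj (node_colour s) (node_colour t) \<and> incident s t"

fun cone_adj :: "'a graph \<Rightarrow> 'a node option \<Rightarrow> 'a node option \<Rightarrow> bool" where
  "cone_adj G None None \<longleftrightarrow> False"
| "cone_adj G None (Some s) \<longleftrightarrow> s \<in> nodes G"
| "cone_adj G (Some s) None \<longleftrightarrow> s \<in> nodes G"
| "cone_adj G (Some s) (Some t) \<longleftrightarrow> node_adj G s t"

abbreviation cone :: "'a graph \<Rightarrow> 'a node option set" where
  "cone G \<equiv> insert None (Some ` nodes G)"

lemma incident_sym: "incident s t \<longleftrightarrow> incident t s"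
  by (cases s; cases t) auto

lemma node_adj_sym: "node_adj G s t \<longleftrightarrow> node_adj G t s"
  by (auto simp: node_adj_def adj_sym[of "node_colour s"] incident_sym[of s])

lemma cone_adj_sym: "cone_adj G x y \<longleftrightarrow> cone_adj G y x"
  by (cases x; cases y) (simp_all add: node_adj_sym)

lemma cone_adj_irrefl: "\<not> cone_adj G x x"
  by (cases x) (simp_all add: node_adj_def adj_irrefl)

lemma cone_adj_cone: "cone_adj G x y \<Longrightarrow> x \<in> cone G \<and> y \<in> cone G"
  by (cases x; cases y) (simp_all add: node_adj_def)

lemma node_adj_Base:
  assumes "s \<in> nodes G" "b \<in> base" "adj (node_colour s) b"
  shows "node_adj G s (Base b)"
  using assms by (cases s) (auto simp: node_adj_def nodes_def)

lemma colour_base: "s \<in> nodes G \<Longrightarrow> node_colour s \<in> base \<Longrightarrow> s = Base (node_colour s)"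
  by (cases s) (auto simp: base_iff)

lemma finite_nodes:
  assumes "G \<in> graphs"
  shows "finite (nodes G)"
proof -
  have V: "finite (verts G)"
    using assms by (simp add: graphs_def)
  have "nodes G \<subseteq> Base ` base \<union> Vert ` verts G \<union> case_prod Tail ` (verts G \<times> verts G)
      \<union> case_prod Head ` (verts G \<times> verts G)"
    using graphs_edge_verts[OF assms] unfolding nodes_def by fastforce
  then show ?thesis
    by (rule finite_subset) (use V in auto)
qed

lemma set_node_nodes: "G \<in> graphs \<Longrightarrow> s \<in> nodes G \<Longrightarrow> set_node s \<subseteq> verts G"
  by (auto simp: nodes_def dest: graphs_edge_verts)

text \<open>The vertices can be read off from the \<open>Vert\<close> nodes and the edges from the
  \<open>Tail\<close> nodes.\<close>

lemma nodes_inj: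
  assumes "G \<in> graphs" "H \<in> graphs" "nodes G = nodes H"
  shows "G = H"
proof -
  have V: "u \<in> verts K \<longleftrightarrow> Vert u \<in> nodes K" for u :: 'a and K
    by (auto simp: nodes_def)
  have E: "{u, v} \<in> edges K \<longleftrightarrow> Tail u v \<in> nodes K" for u v :: 'a and K
    by (auto simp: nodes_def)
  have "edges G \<subseteq> edges H" "edges H \<subseteq> edges G"
    using assms E by (metis graphs_edgeE subsetI)+
  moreover have "verts G = verts H"
    using V assms(3) by blast
  ultimately show ?thesis by simp
qed

text \<open>Renaming labels along \<open>f\<close> keeps colours, incidence and the apex, and sends
  nodes to nodes.\<close>

lemma cone_adj_map:
  assumes f: "graph_hom G H f" and G: "G \<in> graphs" and "cone_adj G x y"
  shows "cone_adj H (map_option (map_node f) x) (map_option (map_node f) y)"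
proof -
  have n: "map_node f s \<in> nodes H" if "s \<in> nodes G" for s
    using f that by (auto simp: graph_hom_def nodes_def)
  have c: "node_colour (map_node f s) = node_colour s" for s
    by (cases s) auto
  have i: "incident (map_node f s) (map_node f t)" if "incident s t" for s t
    using that by (cases s; cases t) auto
  show ?thesis
    using assms(3) n c i by (cases x; cases y) (auto simp: node_adj_def)
qed

text \<open>Homomorphisms are extensional, so identities and composites agree with \<open>id\<close>
  and \<open>g \<circ> f\<close> on \<open>verts G\<close> only; labels of nodes lie there.\<close>

lemma map_node_cong_on:
  assumes "G \<in> graphs" "x \<in> cone G" "\<And>u. u \<in> verts G \<Longrightarrow> f u = g u"
  shows "map_option (map_node f) x = map_option (map_node g) x"
  using assms set_node_nodes[OF assms(1)]
  by (auto intro!: option.map_cong0 node.map_cong0)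

text \<open>The constructed graphs must live on the type \<open>'a\<close> again. An infinite type
  contains a copy of its own square and of the naturals, which yields tagged pairs.\<close>

lemma infinite_inj_node:
  assumes "infinite (UNIV :: 'a set)"
  shows "\<exists>enc :: 'a node option \<Rightarrow> 'a. inj enc"
proof -
  obtain p :: "'a \<times> 'a \<Rightarrow> 'a" where "bij_betw p (UNIV \<times> UNIV) UNIV"
    using card_of_Times_same_infinite[OF assms, folded card_of_ordIso] by blast
  then have p: "inj p"
    by (simp add: bij_betw_def)
  obtain n :: "nat \<Rightarrow> 'a" where n: "inj n"
    using infinite_countable_subset[OF assms] by auto
  define k where "k i u v = p (n i, p (u, v))" for i u v
  have k: "k i u v = k j a b \<longleftrightarrow> i = j \<and> u = a \<and> v = b" for i j u v a b
    by (simp add: k_def inj_eq[OF p] inj_eq[OF n])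
  have "(UNIV :: colour set) = set colours"
    using set_colours by blast
  then have "finite (UNIV :: colour set)"
    by (metis List.finite_set)
  then obtain ci :: "colour \<Rightarrow> nat" where ci: "inj ci"
    using finite_imp_inj_to_nat_seg[of "UNIV :: colour set"] by blast
  \<comment> \<open>Tags 0 to 3 mark the apex and the three kinds of copies, so the colours start at
    4; \<open>undefined\<close> fills the argument places of nodes without labels.\<close>
  define enc where "enc x = (case x of None \<Rightarrow> k 0 undefined undefined
     | Some (Base c) \<Rightarrow> k (4 + ci c) undefined undefined
     | Some (Vert u) \<Rightarrow> k 1 u u | Some (Tail u v) \<Rightarrow> k 2 u v | Some (Head u v) \<Rightarrow> k 3 u v)" for x
  have "inj enc"
  proof (rule injI)
    fix x y assume eq: "enc x = enc y"
    show "x = y"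
    proof (cases x)
      case None
      with eq show ?thesis
        by (cases y) (auto simp: enc_def k split: node.splits)
    next
      case (Some s)
      with eq obtain t where "y = Some t"
        by (cases y; cases s) (auto simp: enc_def k)
      with eq Some show ?thesis
        by (cases s; cases t) (auto simp: enc_def k dest: injD[OF ci])
    qed
  qed
  then show ?thesis by blast
qed

section \<open>The functor, its faithfulness and its injectivity on objects\<close>

locale node_coding =
  fixes enc :: "'a node option \<Rightarrow> 'a"
  assumes inj_enc: "inj enc"
begin

definition construct :: "'a graph \<Rightarrow> 'a graph" where
  "construct G = \<lparr>verts = enc ` cone G, edges = {{enc x, enc y} | x y. cone_adj G x y}\<rparr>"

definition node_map :: "('a \<Rightarrow> 'a) \<Rightarrow> 'a \<Rightarrow> 'a" where
  "node_map f p = enc (map_option (map_node f) (inv enc p))"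

definition construct_map :: "'a graph \<Rightarrow> 'a graph \<Rightarrow> ('a \<Rightarrow> 'a) \<Rightarrow> 'a set \<Rightarrow> 'a set" where
  "construct_map G H f = restrict ((`) (node_map f)) (edges (construct G))"

lemma enc_eq [simp]: "enc x = enc y \<longleftrightarrow> x = y"
  using inj_enc by (simp add: inj_eq)

lemma node_map_enc [simp]: "node_map f (enc x) = enc (map_option (map_node f) x)"
  by (simp add: node_map_def inj_enc)

lemma edge_construct: "{enc x, enc y} \<in> edges (construct G) \<longleftrightarrow> cone_adj G x y"
  by (auto simp: construct_def doubleton_eq_iff cone_adj_sym)

lemma edge_constructE:
  assumes "e \<in> edges (construct G)"
  obtains x y where "e = {enc x, enc y}" "cone_adj G x y"
  using assms by (auto simp: construct_def)

lemma construct_graphs: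
  assumes "G \<in> graphs"
  shows "construct G \<in> graphs"
  unfolding graphs_def
proof (intro CollectI conjI ballI)
  show "finite (verts (construct G))"
    using finite_nodes[OF assms] by (simp add: construct_def)
  fix e assume "e \<in> edges (construct G)"
  then obtain x y where xy: "e = {enc x, enc y}" "cone_adj G x y"
    by (rule edge_constructE)
  then have "x \<noteq> y" "x \<in> cone G" "y \<in> cone G"
    using cone_adj_irrefl cone_adj_cone by metis+
  then show "\<exists>u\<in>verts (construct G). \<exists>v\<in>verts (construct G). u \<noteq> v \<and> e = {u, v}"
    using xy(1) by (intro bexI[of _ "enc x"] bexI[of _ "enc y"]) (auto simp: construct_def)
qed

lemma construct_map_edge:
  "cone_adj G x y \<Longrightarrow> construct_map G H f {enc x, enc y}
     = {enc (map_option (map_node f) x), enc (map_option (map_node f) y)}"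
  by (simp add: construct_map_def edge_construct)

lemma construct_map_eqI:
  assumes "\<phi> \<in> extensional (edges (construct G))"
    and "\<And>x y. cone_adj G x y \<Longrightarrow> \<phi> {enc x, enc y}
      = {enc (map_option (map_node f) x), enc (map_option (map_node f) y)}"
  shows "\<phi> = construct_map G H f"
proof (rule extensionalityI[OF assms(1)])
  show "construct_map G H f \<in> extensional (edges (construct G))"
    by (simp add: construct_map_def)
  fix e assume "e \<in> edges (construct G)"
  then show "\<phi> e = construct_map G H f e"
    by (metis assms(2) construct_map_edge edge_constructE)
qed

lemma cut_continuous_construct_map:
  assumes "G \<in> graphs" "H \<in> graphs" "graph_hom G H f"
  shows "cut_continuous (construct G) (construct H) (construct_map G H f)"
  unfolding construct_map_def
proof (rule cut_continuous_of_hom)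
  show "node_map f v \<in> verts (construct H)" if "v \<in> verts (construct G)" for v
  proof -
    have "v \<in> enc ` cone G"
      using that by (simp add: construct_def)
    then obtain x where x: "v = enc x" "x \<in> cone G"
      by blast
    \<comment> \<open>Being a node means being adjacent to the apex, which
      \<open>cone_adj_map\<close> preserves.\<close>
    have "map_node f s \<in> nodes H" if "s \<in> nodes G" for s
      using cone_adj_map[OF assms(3,1), of None "Some s"] that by simp
    with x show ?thesis
      by (auto simp: construct_def)
  qed
  show "{node_map f u, node_map f v} \<in> edges (construct H)" if uv: "{u, v} \<in> edges (construct G)" for u v
  proof -
    obtain x y where xy: "{u, v} = {enc x, enc y}" "cone_adj G x y"
      using edge_constructE[OF uv] by metis
    then have "node_map f ` {u, v} \<in> edges (construct H)"
      using cone_adj_map[OF assms(3,1) xy(2)] by (simp add: edge_construct)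
    then show ?thesis by simp
  qed
qed (use assms construct_graphs in auto)

lemma embedding: "cat_embedding Graphs_hom Graphs_cc construct construct_map"
proof -
  interpret hom: category "Graphs_hom :: ('a graph, 'a \<Rightarrow> 'a) cat"
    by (rule category_Graphs_hom)
  interpret cc: category "Graphs_cc :: ('a graph, 'a set \<Rightarrow> 'a set) cat"
    by (rule category_Graphs_cc)
  show ?thesis
  proof (unfold_locales, goal_cases)
    case (1 G)
    then show ?case by (simp add: Graphs_hom_def Graphs_cc_def construct_graphs)
  next
    case (2 G H f)
    then show ?case
      by (simp add: Graphs_hom_def Graphs_cc_def cut_continuous_construct_map)
  next
    case (3 G)
    then have G: "G \<in> graphs" by (simp add: Graphs_hom_def)
    have "map_option (map_node (restrict id (verts G))) x = x" if "x \<in> cone G" for x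
      using map_node_cong_on[OF G that, of "restrict id (verts G)" id]
      by (simp add: node.map_id0 option.map_id)
    then have "restrict id (edges (construct G)) = construct_map G G (restrict id (verts G))"
      by (intro construct_map_eqI) (metis cone_adj_cone edge_construct id_apply restrict_apply' restrict_extensional)+
    then show ?case by (simp add: Graphs_hom_def Graphs_cc_def)
  next
    case (4 G H K f g)
    then have G: "G \<in> graphs" and H: "H \<in> graphs" and f: "graph_hom G H f"
      by (simp_all add: Graphs_hom_def)
    have *: "map_option (map_node (compose (verts G) g f)) x
        = map_option (map_node g) (map_option (map_node f) x)" if "x \<in> cone G" for x
      using map_node_cong_on[OF G that, of "compose (verts G) g f" "g \<circ> f"]
      by (simp add: compose_def node.map_comp option.map_comp comp_def)
    have "compose (edges (construct G)) (construct_map H K g) (construct_map G H f)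
        = construct_map G K (compose (verts G) g f)"
    proof (rule construct_map_eqI)
      fix x y assume xy: "cone_adj G x y"
      then have "x \<in> cone G" "y \<in> cone G"
        using cone_adj_cone by metis+
      then show "compose (edges (construct G)) (construct_map H K g) (construct_map G H f) {enc x, enc y}
          = {enc (map_option (map_node (compose (verts G) g f)) x),
             enc (map_option (map_node (compose (verts G) g f)) y)}"
        using xy cone_adj_map[OF f G xy]
        by (simp add: compose_def[of "edges (construct G)"] edge_construct construct_map_edge *)
    qed (simp add: compose_def)
    then show ?case by (simp add: Graphs_hom_def Graphs_cc_def)
  next
    case (5 G H)
    then have G: "G \<in> graphs" by (simp add: Graphs_hom_def)
    show ?case
    proof (rule inj_onI)
      fix f g assume "f \<in> Hom Graphs_hom G H" "g \<in> Hom Graphs_hom G H"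
        and eq: "construct_map G H f = construct_map G H g"
      then have ext: "f \<in> extensional (verts G)" "g \<in> extensional (verts G)"
        by (auto simp: Graphs_hom_def graph_hom_def PiE_def)
      have "f u = g u" if "u \<in> verts G" for u
      proof -
        \<comment> \<open>The apex is fixed, so the image of its edge to \<open>Vert u\<close>
          reveals the label \<open>f u\<close>.\<close>
        have "cone_adj G None (Some (Vert u))"
          using that by (simp add: nodes_def)
        from construct_map_edge[OF this, of H f] construct_map_edge[OF this, of H g] eq
        show ?thesis by (simp add: doubleton_eq_iff)
      qed
      then show "f = g"
        by (rule extensionalityI[OF ext])
    qed
  next
    case 6
    show ?case
    proof (rule inj_onI)
      fix G H :: "'a graph"
      assume "G \<in> Obj Graphs_hom" "H \<in> Obj Graphs_hom" and eq: "construct G = construct H"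
      then have GH: "G \<in> graphs" "H \<in> graphs"
        by (simp_all add: Graphs_hom_def)
      have "enc ` cone G = enc ` cone H"
        using eq by (simp add: construct_def)
      then have "cone G = cone H"
        using inj_image_eq_iff[OF inj_enc] by metis
      then have "nodes G = nodes H" by auto
      then show "G = H" by (rule nodes_inj[OF GH])
    qed
  qed
qed

section \<open>Fullness: recovering a homomorphism from a cut-continuous mapping\<close>

lemma construct_full:
  assumes G: "G \<in> graphs" and H: "H \<in> graphs"
    and h: "cut_continuous (construct G) (construct H) h"
  obtains f where "graph_hom G H f" "h = construct_map G H f"
proof -
  note FG = construct_graphs[OF G] and FH = construct_graphs[OF H]
  \<comment> \<open>The images of the edges at the apex determine \<open>h\<close>, since every
    other edge closes a triangle with two of them.\<close>
  define S where "S s = h {enc None, enc (Some s)}" for s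
  have hE: "h {enc x, enc y} \<in> edges (construct H)" if "cone_adj G x y" for x y
    using h that by (auto simp: cut_continuous_def edge_construct)
  have card2: "card e = 2" if "e \<in> edges (construct H)" for e
    using graphs_edgeE[OF FH that] by (metis card_2_iff)
  have cS: "card (S s) = 2" if "s \<in> nodes G" for s
    unfolding S_def using that by (intro card2 hE) simp
  have hS: "h {enc (Some s), enc (Some t)} = sym_diff (S s) (S t)" if st: "node_adj G s t" for s t
    unfolding S_def using st
    by (intro cut_continuous_triangle[OF FG FH h]) (simp_all add: edge_construct node_adj_def)
  have cD: "card (sym_diff (S s) (S t)) = 2" if "node_adj G s t" for s t
    using hE[of "Some s" "Some t"] hS[OF that] card2 that by simp
  \<comment> \<open>Together with the apex the four nodes span a \<open>K5\<close>. The symmetric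
    differences of the sets \<open>S\<close> are images of edges, hence pairs, as
    \<open>four_pairs_star\<close> demands.\<close>
  have K4: "p \<in> S c" if p: "p \<in> S a" "p \<in> S b"
      and K: "node_adj G a b" "node_adj G a c" "node_adj G a d" "node_adj G b c" "node_adj G b d" "node_adj G c d"
    for p a b c d
  proof -
    have "a \<in> nodes G" "b \<in> nodes G" "c \<in> nodes G" "d \<in> nodes G"
      using K by (simp_all add: node_adj_def)
    then show ?thesis
      by (rule four_pairs_star[OF cS cS cS cS cD cD cD cD cD cD p, OF _ _ _ _ K])
  qed
  have Base: "Base b \<in> nodes G" if "b \<in> base" for b
    using that by (simp add: nodes_def)
  have BB: "node_adj G (Base a) (Base b)" if "a \<in> base" "b \<in> base" "adj a b" for a b
    using node_adj_Base[OF Base] that by simp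
  have K4B: "p \<in> S (Base c)" if "p \<in> S (Base a)" "p \<in> S (Base b)"
    and "list_all (\<lambda>x. x \<in> base) [a, b, c, d]"
    and "adj a b" "adj a c" "adj a d" "adj b c" "adj b d" "adj c d" for p a b c d
    using that by (intro K4[of p "Base a" "Base b" "Base c" "Base d"] BB) simp_all

  have "S (Base D0) \<inter> S (Base D1) \<noteq> {}"
    by (rule conjunct2[OF card2_meet[OF cS cS cD]]; (intro Base BB)?) (simp_all add: base_colours_def adj_def)
  then obtain p where p: "p \<in> S (Base D0)" "p \<in> S (Base D1)"
    by blast
  note simps = base_colours_def adj_def
  \<comment> \<open>From here \<open>p\<close> spreads through the base: each \<open>K4\<close> used
    contains two vertices already reached, the new vertex and one auxiliary vertex.\<close>
  have p2: "p \<in> S (Base D2)" using K4B[OF p, of D2 D3] by (simp add: simps)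
  have p3: "p \<in> S (Base D3)" using K4B[OF p, of D3 D2] by (simp add: simps)
  have p4: "p \<in> S (Base D4)" using K4B[OF p(1) p3, of D4 D1] by (simp add: simps)
  have p6: "p \<in> S (Base D6)" using K4B[OF p(1) p2, of D6 D9] by (simp add: simps)
  have p9: "p \<in> S (Base D9)" using K4B[OF p(1) p2, of D9 D6] by (simp add: simps)
  have p5: "p \<in> S (Base D5)" using K4B[OF p(1) p3, of D5 D4] by (simp add: simps)
  have p8: "p \<in> S (Base D8)" using K4B[OF p2 p6, of D8 D9] by (simp add: simps)
  have p7: "p \<in> S (Base D7)" using K4B[OF p3 p4, of D7 D5] by (simp add: simps)
  have pB: "p \<in> S (Base b)" if "b \<in> base" for b
    using that p p2 p3 p4 p5 p6 p7 p8 p9 by (auto simp: base_colours_def)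
  have pS: "p \<in> S s" if s: "s \<in> nodes G" for s
  proof -
    \<comment> \<open>Every node lies in a \<open>K4\<close> with three base nodes, two of which
      pass \<open>p\<close> on to it.\<close>
    obtain d where d: "d \<in> base" "adj (node_colour s) d"
      using ex_base_adj by blast
    then obtain a b where "a \<in> base" "b \<in> base" "adj a b"
      "adj (node_colour s) a" "adj (node_colour s) b" "adj d a" "adj d b"
      using edge_in_K4[of "node_colour s" d] by blast
    with d s show ?thesis
      by (intro K4[of p "Base a" "Base b" s "Base d"] pB)
        (simp_all add: BB node_adj_Base node_adj_sym[of G _ s] adj_sym[of _ d])
  qed

  have "p \<in> \<Union> (edges (construct H))"
    using p(1) hE[of None "Some (Base D0)"] Base[of D0] by (auto simp: S_def base_colours_def)
  then obtain w where w: "p = enc w"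
    by (auto elim!: edge_constructE)
  have "\<exists>y. S s = {enc w, enc y} \<and> cone_adj H w y" if s: "s \<in> nodes G" for s
  proof -
    have "S s \<in> edges (construct H)"
      unfolding S_def using s by (intro hE) simp
    then obtain x y where "S s = {enc x, enc y}" "cone_adj H x y"
      by (rule edge_constructE)
    then show ?thesis
      using pS[OF s] cone_adj_sym[of H x y] unfolding w by (auto simp: insert_commute)
  qed
  then obtain \<psi> where \<psi>: "\<And>s. s \<in> nodes G \<Longrightarrow> S s = {enc w, enc (\<psi> s)} \<and> cone_adj H w (\<psi> s)"
    by metis
  \<comment> \<open>The common end \<open>enc w\<close> cancels in the symmetric difference of
    \<open>S s\<close> and \<open>S t\<close>, leaving the two other ends.\<close>
  have h\<psi>: "h {enc (Some s), enc (Some t)} = {enc (\<psi> s), enc (\<psi> t)}" if st: "node_adj G s t" for s t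
  proof -
    have n: "s \<in> nodes G" "t \<in> nodes G"
      using st by (simp_all add: node_adj_def)
    have "\<psi> s \<noteq> \<psi> t"
      using cD[OF st] \<psi>[OF n(1)] \<psi>[OF n(2)] by auto
    moreover have "\<psi> s \<noteq> w" "\<psi> t \<noteq> w"
      using \<psi>[OF n(1)] \<psi>[OF n(2)] cone_adj_irrefl by metis+
    ultimately show ?thesis
      using hS[OF st] \<psi>[OF n(1)] \<psi>[OF n(2)] by auto
  qed
  have \<psi>_adj: "cone_adj H (\<psi> s) (\<psi> t)" if st: "node_adj G s t" for s t
    using hE[of "Some s" "Some t"] h\<psi>[OF st] st by (simp add: edge_construct)

  text \<open>
    If \<open>w\<close> were not the apex, then \<open>\<psi>\<close> would map the base into a cone over the link of a vertex
    of the rigid graph; that cone is four-colourable, whereas the base is not.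
  \<close>
  have "w = None"
  proof (rule ccontr)
    assume "w \<noteq> None"
    then obtain t where t: "w = Some t" by blast
    \<comment> \<open>All values of \<psi> are neighbours of \<open>t\<close>: the apex goes to the
      fourth colour \<open>D0\<close>, the others are folded by the 3-colouring of the link of the
      colour of \<open>t\<close>.\<close>
    define g where "g c = (case \<psi> (Base c) of None \<Rightarrow> D0 | Some s \<Rightarrow> link_fold (node_colour t) (node_colour s))" for c
    have "adj (g c) (g d)" if cd: "c \<in> base" "d \<in> base" "adj c d" for c d
    proof -
      have 1: "cone_adj H (Some t) (\<psi> (Base c))" "cone_adj H (Some t) (\<psi> (Base d))"
        using \<psi> Base cd t by auto
      have 2: "cone_adj H (\<psi> (Base c)) (\<psi> (Base d))"
        using \<psi>_adj BB cd by blast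
      show ?thesis
        using 1 2 unfolding g_def
        by (cases "\<psi> (Base c)"; cases "\<psi> (Base d)")
          (simp_all add: node_adj_def link_three_colourable link_fold_D0)
    qed
    \<comment> \<open>Contradictory, because \<open>g\<close> takes only the values
      \<open>D0\<close> to \<open>D3\<close>.\<close>
    then have "g D4 = D4"
      by (rule rigid) (simp_all add: base_colours_def)
    then show False
      by (simp add: g_def link_fold_def split: option.splits if_splits)
  qed
  define \<chi> where "\<chi> s = the (\<psi> s)" for s
  have \<chi>: "\<psi> s = Some (\<chi> s) \<and> \<chi> s \<in> nodes H" if "s \<in> nodes G" for s
    using \<psi>[OF that] \<open>w = None\<close> by (cases "\<psi> s") (simp_all add: \<chi>_def)
  have \<chi>_adj: "node_adj H (\<chi> s) (\<chi> t)" if "node_adj G s t" for s t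
    using \<psi>_adj[OF that] \<chi> that by (simp add: node_adj_def)
  have \<chi>_Base: "\<chi> (Base c) = Base c" if c: "c \<in> base" for c
  proof -
    \<comment> \<open>Rigidity gives only the colour of the image; a base colour, however, is
      carried by a single node.\<close>
    have "node_colour (\<chi> (Base c)) = c"
    proof (rule rigid[of "\<lambda>c. node_colour (\<chi> (Base c))", OF _ c])
      show "adj (node_colour (\<chi> (Base v))) (node_colour (\<chi> (Base w)))"
        if "v \<in> base" "w \<in> base" "adj v w" for v w
        using \<chi>_adj[OF BB[OF that]] by (simp add: node_adj_def)
    qed
    then show ?thesis
      using colour_base[of "\<chi> (Base c)" H] \<chi>[OF Base[OF c]] c by simp
  qed
  have colour_\<chi>: "node_colour (\<chi> s) = node_colour s" if s: "s \<in> nodes G" for s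
  proof (cases "node_colour s \<in> base")
    case True
    then show ?thesis
      using colour_base[OF s] \<chi>_Base by metis
  next
    case False
    show ?thesis
    proof (rule undominated[OF False])
      fix b assume b: "b \<in> base" "adj (node_colour s) b"
      then show "adj (node_colour (\<chi> s)) b"
        using \<chi>_adj[OF node_adj_Base[OF s b]] \<chi>_Base[OF b(1)] by (simp add: node_adj_def)
    qed
  qed

  have "\<exists>u'. \<chi> (Vert u) = Vert u'" if "u \<in> verts G" for u
    using colour_\<chi>[of "Vert u"] \<chi>[of "Vert u"] that by (cases "\<chi> (Vert u)") (auto simp: nodes_def base_iff)
  then obtain f where f: "\<And>u. u \<in> verts G \<Longrightarrow> \<chi> (Vert u) = Vert (f u)"
    by metis
  have edge: "\<chi> (Tail u v) = Tail (f u) (f v) \<and> \<chi> (Head u v) = Head (f u) (f v)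
      \<and> {f u, f v} \<in> edges H" if uv: "{u, v} \<in> edges G" for u v
  proof -
    have n: "Vert u \<in> nodes G" "Vert v \<in> nodes G" "Tail u v \<in> nodes G" "Head u v \<in> nodes G"
      using graphs_edge_verts[OF G uv] uv by (auto simp: nodes_def)
    obtain a b where T: "\<chi> (Tail u v) = Tail a b"
      using colour_\<chi>[OF n(3)] \<chi>[OF n(3)] by (cases "\<chi> (Tail u v)") (auto simp: nodes_def base_iff)
    obtain c d where H': "\<chi> (Head u v) = Head c d"
      using colour_\<chi>[OF n(4)] \<chi>[OF n(4)] by (cases "\<chi> (Head u v)") (auto simp: nodes_def base_iff)
    \<comment> \<open>The images of the three edges of the path must be incident: the first gives
      \<open>a = f u\<close>, the second \<open>c = a\<close> and \<open>d = b\<close>, the third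
      \<open>d = f v\<close>. That \<open>Tail (f u) (f v)\<close> is a node of \<open>H\<close>
      then makes \<open>{f u, f v}\<close> an edge.\<close>
    have "node_adj G (Vert u) (Tail u v)" "node_adj G (Tail u v) (Head u v)" "node_adj G (Vert v) (Head u v)"
      using n by (simp_all add: node_adj_def adj_def)
    then have "a = f u \<and> c = a \<and> d = b \<and> d = f v"
      using \<chi>_adj T H' f graphs_edge_verts[OF G uv] by (fastforce simp: node_adj_def)
    then show ?thesis
      using T H' \<chi>[OF n(3)] by (auto simp: nodes_def)
  qed
  \<comment> \<open>The choice of \<open>f\<close> is determined on \<open>verts G\<close> only;
    restricting makes it extensional, as \<open>graph_hom\<close> requires.\<close>
  define f' where "f' = restrict f (verts G)"
  have \<chi>_map: "\<chi> s = map_node f' s" if s: "s \<in> nodes G" for s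
    using s \<chi>_Base f edge graphs_edge_verts[OF G] unfolding nodes_def f'_def by auto
  have fV: "f u \<in> verts H" if u: "u \<in> verts G" for u
    using \<chi>[of "Vert u"] f[OF u] u by (auto simp: nodes_def)
  have hom: "graph_hom G H f'"
    unfolding graph_hom_def f'_def using fV edge graphs_edge_verts[OF G] by auto
  have "h = construct_map G H f'"
  proof (rule construct_map_eqI)
    show "h \<in> extensional (edges (construct G))"
      using h by (auto simp: cut_continuous_def PiE_def)
    fix x y assume xy: "cone_adj G x y"
    have S': "S s = {enc None, enc (Some (map_node f' s))}" if "s \<in> nodes G" for s
      using \<psi>[OF that] \<chi>[OF that] \<chi>_map[OF that] \<open>w = None\<close> by simp
    show "h {enc x, enc y} = {enc (map_option (map_node f') x), enc (map_option (map_node f') y)}"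
    proof (cases x; cases y)
      fix s t assume "x = Some s" "y = Some t"
      then show ?thesis
        using xy h\<psi>[of s t] \<chi> \<chi>_map by (auto simp: node_adj_def)
    qed (use xy S' in \<open>auto simp: S_def insert_commute\<close>)
  qed
  with hom show thesis by (rule that)
qed

end

theorem theorem3:
  assumes "infinite (UNIV :: 'a set)"
  shows "\<exists>(F :: 'a graph \<Rightarrow> 'a graph)
          (Fm :: 'a graph \<Rightarrow> 'a graph \<Rightarrow> ('a \<Rightarrow> 'a) \<Rightarrow> ('a set \<Rightarrow> 'a set)).
    (\<forall>G \<in> graphs. F G \<in> graphs) \<and>
    (\<forall>G \<in> graphs. \<forall>H \<in> graphs.
       (\<exists>f. graph_hom G H f) \<longleftrightarrow> (\<exists>g. cut_continuous (F G) (F H) g)) \<and>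
    cat_embedding Graphs_hom Graphs_cc F Fm \<and>
    (\<forall>G \<in> graphs. \<forall>H \<in> graphs. \<forall>g. cut_continuous (F G) (F H) g \<longrightarrow>
       (\<exists>f. graph_hom G H f \<and> g = Fm G H f))"
proof -
  obtain enc :: "'a node option \<Rightarrow> 'a" where "inj enc"
    using infinite_inj_node[OF assms] by blast
  then interpret node_coding enc
    by unfold_locales
  show ?thesis
  proof (intro exI[of _ construct] exI[of _ construct_map] conjI ballI allI impI)
    fix G H :: "'a graph" assume GH: "G \<in> graphs" "H \<in> graphs"
    show "(\<exists>f. graph_hom G H f) \<longleftrightarrow> (\<exists>g. cut_continuous (construct G) (construct H) g)"
      using cut_continuous_construct_map[OF GH] construct_full[OF GH] by metis
    show "\<exists>f. graph_hom G H f \<and> g = construct_map G H f"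
      if "cut_continuous (construct G) (construct H) g" for g
      using construct_full[OF GH that] by blast
  qed (simp_all add: construct_graphs embedding)
qed

end
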